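(* Let $k\ge 1$ be an integer, let $x_1,\ldots,x_k$ be pairwise different real numbers, and define $$S_k(x_1,\ldots,x_k)=\sum_{n_1=1}^{\infty}\cdots\sum_{n_k=1}^{\infty}\frac{x_1^{n_1}\cdots x_k^{n_k}}{(n_1+\cdots+n_k)!},\qquad \exp_k(x)=\sum_{n=0}^{\infty}\frac{x^n}{(n+k)!}.$$ Then $$S_k(x_1,\ldots,x_k)=x_1\cdots x_k\cdot\left[x_1,\ldots,x_k;\,x^{k-1}\exp_k(x)\right],$$ where the bracket is the divided difference of the function $x\mapsto x^{k-1}\exp_k(x)$ at the knots $x_1,\ldots,x_k$.
   Context: For pairwise different real or complex numbers $x_0,\ldots,x_m$, the divided differences of a function $f$ are defined recursively by $[x_0;f]=f(x_0)$ and $$[x_0,\ldots,x_m;f]=\frac{[x_1,\ldots,x_m;f]-[x_0,\ldots,x_{m-1};f]}{x_m-x_0}.$$ The notation $[x_1,\ldots,x_k;\,h(x)]$ means the divided difference of the function $x\mapsto h(x)$. *)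

theory Defs
  imports "HOL-Analysis.Analysis"
begin

text \<open>The value at the empty list of knots is a dummy.\<close>

function divided_difference :: "'a::field list \<Rightarrow> ('a \<Rightarrow> 'a) \<Rightarrow> 'a" where
  "divided_difference [] f = 0"
| "divided_difference [x] f = f x"
| "divided_difference (x # y # zs) f =
     (divided_difference (y # zs) f - divided_difference (butlast (x # y # zs)) f)
       / (last (y # zs) - x)"
  by pat_completeness auto
termination by (relation "Wellfounded.measure (\<lambda>(xs, f). length xs)") auto

text \<open>\<open>iterated_series k g\<close> is the \<open>k\<close>-fold iterated series of \<open>g [n\<^sub>1, \<dots>, n\<^sub>k]\<close> with every
  \<open>n\<^sub>i\<close> running from \<open>1\<close> to infinity, \<open>n\<^sub>1\<close> outermost; hence the shift by \<open>Suc\<close>.\<close>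

primrec iterated_series :: "nat \<Rightarrow> (nat list \<Rightarrow> real) \<Rightarrow> real" where
  "iterated_series 0 g = g []"
| "iterated_series (Suc k) g = (\<Sum>n. iterated_series k (\<lambda>ns. g (Suc n # ns)))"

definition S_term :: "real list \<Rightarrow> nat list \<Rightarrow> real" where
  "S_term xs ns = (\<Prod>i<length xs. (xs ! i) ^ (ns ! i)) / fact (sum_list ns)"

definition S :: "nat \<Rightarrow> real list \<Rightarrow> real" where
  "S k xs = iterated_series k (S_term xs)"

definition exp_k :: "nat \<Rightarrow> real \<Rightarrow> real" where
  "exp_k k x = (\<Sum>n. x ^ n / fact (n + k))"

end

theory Submission imports Defs begin

(* Grouping the k-fold series by m = n_1 + ... + n_k - k turns it into
   x_1 ... x_k * (sum over m of h_m(x_1,...,x_k) / (m + k)!), where h_m is the complete homogeneous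
   symmetric polynomial. Since h_m(x_1,...,x_k) = [x_1,...,x_k; x^(m+k-1)] and divided differences
   are continuous under pointwise convergence, this is the divided difference of
   the function sum over m of x^(m+k-1) / (m + k)! = x^(k-1) exp_k(x). *)

section \<open>Divided differences and complete homogeneous symmetric polynomials\<close>

text \<open>A monomial of degree m + 1 either avoids the first variable or is that variable times a
  monomial of degree m; the recursion follows this split.\<close>

fun complete_homogeneous :: "nat \<Rightarrow> 'a::comm_ring_1 list \<Rightarrow> 'a" where
  "complete_homogeneous 0 xs = 1"
| "complete_homogeneous (Suc m) [] = 0"
| "complete_homogeneous (Suc m) (x # xs) =
     complete_homogeneous (Suc m) xs + x * complete_homogeneous m (x # xs)"

text \<open>The definition splits off the first variable, but divided differences also drop the last
  knot. The recursion at the far end comes from an induction on the list with an inner induction on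
  the degree.\<close>

lemma complete_homogeneous_snoc:
  "complete_homogeneous (Suc m) (xs @ [y]) =
     complete_homogeneous (Suc m) xs + y * complete_homogeneous m (xs @ [y])"
proof (induction xs arbitrary: m)
  case Nil
  show ?case by simp
next
  case (Cons x xs)
  show ?case
  proof (induction m)
    case 0
    show ?case using Cons.IH[of 0] by simp
  next
    case (Suc m)
    have "complete_homogeneous (Suc (Suc m)) ((x # xs) @ [y]) =
        complete_homogeneous (Suc (Suc m)) (xs @ [y])
          + x * complete_homogeneous (Suc m) ((x # xs) @ [y])"
      by simp
    also have "\<dots> = complete_homogeneous (Suc (Suc m)) (x # xs)
        + y * (complete_homogeneous (Suc m) (xs @ [y])
          + x * complete_homogeneous m ((x # xs) @ [y]))"
      unfolding Cons.IH[of "Suc m"] Suc.IH by (simp add: algebra_simps)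
    finally show ?case by simp
  qed
qed

text \<open>Expand \<open>complete_homogeneous (Suc m) (x # zs @ [y])\<close> once at
  \<open>x\<close> and once at \<open>y\<close>, and compare.\<close>

lemma complete_homogeneous_tail_minus_butlast:
  "complete_homogeneous (Suc m) (zs @ [y]) - complete_homogeneous (Suc m) (x # zs) =
     (y - x) * complete_homogeneous m (x # zs @ [y])"
proof -
  have "complete_homogeneous (Suc m) (zs @ [y]) + x * complete_homogeneous m (x # zs @ [y])
      = complete_homogeneous (Suc m) (x # zs) + y * complete_homogeneous m (x # zs @ [y])"
    using complete_homogeneous_snoc[of m "x # zs" y] by simp
  then show ?thesis by (simp add: algebra_simps)
qed

lemma complete_homogeneous_singleton: "complete_homogeneous m [x] = x ^ m"
  by (induction m) auto

lemma divided_difference_Cons_snoc: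
  "divided_difference (x # zs @ [y]) f =
     (divided_difference (zs @ [y]) f - divided_difference (x # zs) f) / (y - x)"
proof (cases zs)
  case (Cons z ws)
  then have "zs @ [y] = z # (ws @ [y])" by simp
  then show ?thesis
    by (simp add: butlast_append Cons)
qed simp

text \<open>Induction on the number of knots. With one knot fewer the same exponent belongs to
  degree \<open>Suc m\<close>, and the difference of the two resulting polynomials contains the
  factor \<open>y - x\<close>, which cancels because the knots are distinct.\<close>

lemma divided_difference_power:
  assumes "distinct xs" "xs \<noteq> []"
  shows "divided_difference xs (\<lambda>x. x ^ (m + (length xs - 1))) = complete_homogeneous m xs"
  using assms
proof (induction "length xs" arbitrary: xs m rule: less_induct)
  case less
  then obtain x ys where xs: "xs = x # ys" by (cases xs) auto
  show ?case
  proof (cases ys rule: rev_cases)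
    case Nil
    then show ?thesis by (simp add: xs complete_homogeneous_singleton)
  next
    case (snoc zs y)
    have tail: "divided_difference (zs @ [y]) (\<lambda>x. x ^ (Suc m + length zs))
        = complete_homogeneous (Suc m) (zs @ [y])"
      using less(1)[of "zs @ [y]" "Suc m"] less(2) by (simp add: xs snoc)
    have butl: "divided_difference (x # zs) (\<lambda>x. x ^ (Suc m + length zs))
        = complete_homogeneous (Suc m) (x # zs)"
      using less(1)[of "x # zs" "Suc m"] less(2) by (simp add: xs snoc)
    have "x \<noteq> y" using less(2) by (auto simp: xs snoc)
    moreover have "m + (length xs - 1) = Suc m + length zs" by (simp add: xs snoc)
    ultimately show ?thesis
      unfolding xs snoc divided_difference_Cons_snoc
      by (simp only: tail butl complete_homogeneous_tail_minus_butlast) simp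
  qed
qed

lemma divided_difference_mult_right:
  "divided_difference xs (\<lambda>x. f x * c) = divided_difference xs f * c"
  by (induction xs f rule: divided_difference.induct)
    (simp_all del: butlast.simps add: left_diff_distrib)

text \<open>A divided difference is a finite linear combination of values at the knots, so
  convergence there suffices.\<close>

lemma sums_divided_difference:
  fixes f :: "'a::real_normed_field \<Rightarrow> 'a"
  assumes "\<And>x. x \<in> set xs \<Longrightarrow> (\<lambda>n. g n x) sums f x"
  shows "(\<lambda>n. divided_difference xs (g n)) sums divided_difference xs f"
  using assms
proof (induction xs f rule: divided_difference.induct)
  case (3 x y zs f)
  show ?case
    unfolding divided_difference.simps
    by (intro sums_divide sums_diff "3.IH" "3.prems")
      (auto dest: in_set_butlastD simp del: butlast.simps)
qed auto

section \<open>Iterated series as unordered sums\<close>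

lemma bij_betw_Cons_lists_of_length:
  "bij_betw (\<lambda>(n, ns). n # ns) (UNIV \<times> {ns. length ns = k}) {ns. length ns = Suc k}"
  unfolding bij_betw_def by (auto simp: inj_on_def image_iff length_Suc_conv)

text \<open>Fubini for unordered sums, peeling off the outermost index. \<open>map Suc\<close> lets
  all entries start at 0, in accordance with the shift in \<open>iterated_series\<close>.\<close>

lemma iterated_series_eq_infsum:
  assumes "(\<lambda>ns. g (map Suc ns)) summable_on {ns. length ns = k}"
  shows "iterated_series k g = (\<Sum>\<^sub>\<infinity>ns\<in>{ns. length ns = k}. g (map Suc ns))"
  using assms
proof (induction k arbitrary: g)
  case 0
  have "{ns::nat list. length ns = 0} = {[]}" by auto
  then show ?case by simp
next
  case (Suc k)
  let ?D = "{ns::nat list. length ns = k}"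
  have summ: "(\<lambda>(n, ns). g (Suc n # map Suc ns)) summable_on UNIV \<times> ?D"
    using Suc.prems unfolding summable_on_reindex_bij_betw[OF bij_betw_Cons_lists_of_length, symmetric]
    by (simp add: case_prod_unfold)
  have inner: "iterated_series k (\<lambda>ns. g (Suc n # ns)) = (\<Sum>\<^sub>\<infinity>ns\<in>?D. g (Suc n # map Suc ns))" for n
    using summable_on_SigmaD1[OF summ, of n] by (intro Suc.IH) simp
  have "iterated_series (Suc k) g = (\<Sum>n. \<Sum>\<^sub>\<infinity>ns\<in>?D. g (Suc n # map Suc ns))"
    by (simp add: inner)
  \<comment> \<open>The inner sums are summable over all n, so their ordinary series has the same
    value as their unordered sum.\<close>
  also have "\<dots> = (\<Sum>\<^sub>\<infinity>n. \<Sum>\<^sub>\<infinity>ns\<in>?D. g (Suc n # map Suc ns))"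
    using summable_on_Sigma_banach[OF summ]
    by (intro sums_unique[symmetric] has_sum_imp_sums has_sum_infsum)
  also have "\<dots> = (\<Sum>\<^sub>\<infinity>(n, ns)\<in>UNIV \<times> ?D. g (Suc n # map Suc ns))"
    by (rule infsum_Sigma'_banach[OF summ])
  also have "\<dots> = (\<Sum>\<^sub>\<infinity>ns\<in>{ns. length ns = Suc k}. g (map Suc ns))"
    by (subst infsum_reindex_bij_betw[OF bij_betw_Cons_lists_of_length, symmetric])
      (simp add: case_prod_unfold)
  finally show ?case .
qed

text \<open>Tonelli: with first entry n fixed, the inner sum is \<open>F 0 n\<close> times a
  constant, which is again summable in n.\<close>

lemma summable_on_prod_nth:
  fixes F :: "nat \<Rightarrow> nat \<Rightarrow> real"
  assumes "\<And>i. i < k \<Longrightarrow> F i summable_on UNIV" "\<And>i n. F i n \<ge> 0"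
  shows "(\<lambda>ns. \<Prod>i<k. F i (ns ! i)) summable_on {ns. length ns = k}"
  using assms
proof (induction k arbitrary: F)
  case 0
  then show ?case by (simp add: summable_on_finite)
next
  case (Suc k)
  let ?P = "\<lambda>ns. \<Prod>i<k. F (Suc i) (ns ! i)"
  have IH: "?P summable_on {ns. length ns = k}"
    by (rule Suc.IH) (use Suc.prems in auto)
  have "(\<lambda>(n, ns). F 0 n * ?P ns) summable_on UNIV \<times> {ns. length ns = k}"
  proof (rule summable_on_SigmaI)
    show "((\<lambda>ns. case (n, ns) of (n, ns) \<Rightarrow> F 0 n * ?P ns) has_sum
        F 0 n * infsum ?P {ns. length ns = k}) {ns. length ns = k}" for n
      using has_sum_cmult_right[OF has_sum_infsum[OF IH]] by simp
    show "(\<lambda>n. F 0 n * infsum ?P {ns. length ns = k}) summable_on UNIV"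
      by (intro summable_on_cmult_left Suc.prems) simp
  qed (auto intro!: mult_nonneg_nonneg prod_nonneg Suc.prems)
  then show ?case
    unfolding summable_on_reindex_bij_betw[OF bij_betw_Cons_lists_of_length, symmetric]
    by (simp add: case_prod_unfold prod.lessThan_Suc_shift del: prod.lessThan_Suc)
qed

section \<open>Grouping the multiple series by total degree\<close>

text \<open>Multinomial coefficients are positive integers: at each step
  \<open>fact n * fact m\<close> divides \<open>fact (n + m)\<close>.\<close>

lemma prod_fact_le_fact_sum_list:
  "(\<Prod>i<length ns. fact (ns ! i)) \<le> (fact (sum_list ns) :: nat)"
proof (induction ns)
  case (Cons n ns)
  have "fact n * (\<Prod>i<length ns. fact (ns ! i)) \<le> fact n * (fact (sum_list ns) :: nat)"
    using Cons.IH by simp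
  also have "\<dots> \<le> fact (n + sum_list ns)"
    by (intro dvd_imp_le fact_fact_dvd_fact) simp
  finally show ?case by (simp add: prod.lessThan_Suc_shift del: prod.lessThan_Suc)
qed simp

text \<open>The terms are dominated by those of the product of the exponential series at the
  \<bar>x_i\<bar>. Zero exponents are included here; positive ones are a subset.\<close>

lemma summable_on_S_term: "S_term xs summable_on {ns. length ns = length xs}"
proof -
  let ?F = "\<lambda>i n. \<bar>xs ! i\<bar> ^ n / fact n"
  have "(\<lambda>ns. \<Prod>i<length xs. ?F i (ns ! i)) summable_on {ns. length ns = length xs}"
  proof (rule summable_on_prod_nth)
    fix i
    have "summable (?F i)"
      using summable_exp[of "\<bar>xs ! i\<bar>"] by (simp add: field_simps)
    then show "?F i summable_on UNIV"
      by (subst summable_on_UNIV_nonneg_real_iff) auto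
  qed auto
  then have "(\<lambda>ns. \<bar>S_term xs ns\<bar>) summable_on {ns. length ns = length xs}"
  proof (rule summable_on_comparison_test)
    fix ns :: "nat list"
    assume "ns \<in> {ns. length ns = length xs}"
    then have len: "length ns = length xs" by simp
    have "real (\<Prod>i<length xs. fact (ns ! i)) \<le> real (fact (sum_list ns))"
      using prod_fact_le_fact_sum_list[of ns] unfolding len of_nat_le_iff .
    then have le: "(\<Prod>i<length xs. fact (ns ! i)) \<le> (fact (sum_list ns) :: real)"
      by simp
    have pos: "(\<Prod>i<length xs. fact (ns ! i)) > (0::real)"
      by (rule prod_pos) simp
    show "\<bar>S_term xs ns\<bar> \<le> (\<Prod>i<length xs. ?F i (ns ! i))"
      unfolding S_term_def prod_dividef abs_divide abs_prod power_abs abs_of_pos[OF fact_gt_zero]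
      by (rule divide_left_mono[OF le]) (auto intro!: prod_nonneg mult_pos_pos pos)
  qed auto
  \<comment> \<open>For real terms, unordered summability is the same as absolute
    summability.\<close>
  then show ?thesis
    by (subst summable_on_iff_abs_summable_on_real) simp
qed

lemma bij_betw_map_Suc:
  "bij_betw (map Suc) {ns. length ns = k} {ns. length ns = k \<and> (\<forall>n\<in>set ns. n \<ge> 1)}"
  by (rule bij_betwI[where g = "map (\<lambda>n. n - 1)"]) (auto simp: o_def intro!: map_idI)

lemma sum_list_map_Suc: "sum_list (map Suc ns) = sum_list ns + length ns"
  by (induction ns) auto

lemma prod_list_eq_prod_nth: "prod_list xs = (\<Prod>i<length xs. xs ! i)"
  by (induction xs) (simp_all add: prod.lessThan_Suc_shift del: prod.lessThan_Suc)

text \<open>Raising every exponent by one releases the factor x_1 ... x_k and adds k to the total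
  degree.\<close>

lemma S_term_map_Suc:
  assumes "length ns = length xs"
  shows "S_term xs (map Suc ns) =
    prod_list xs * (\<Prod>i<length xs. (xs ! i) ^ (ns ! i)) / fact (sum_list ns + length xs)"
  using assms by (simp add: S_term_def prod_list_eq_prod_nth sum_list_map_Suc prod.distrib)

lemma finite_lists_length_sum: "finite {ns::nat list. length ns = k \<and> sum_list ns = m}"
proof (rule finite_subset)
  show "{ns::nat list. length ns = k \<and> sum_list ns = m} \<subseteq> {ns. set ns \<subseteq> {..m} \<and> length ns = k}"
    by (auto dest: member_le_sum_list)
qed (rule finite_lists_length_eq, simp)

text \<open>This links the recursive polynomial to the series: splitting exponent lists by whether
  the first exponent vanishes reproduces the recursion.\<close>

lemma sum_monomials_eq_complete_homogeneous:
  "(\<Sum>ns | length ns = length xs \<and> sum_list ns = m. \<Prod>i<length xs. (xs ! i) ^ (ns ! i)) =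
     complete_homogeneous m xs"
proof (induction m xs rule: complete_homogeneous.induct)
  case (1 xs)
  have "{ns. length ns = length xs \<and> sum_list ns = 0} = {replicate (length xs) (0::nat)}"
    by (auto simp: sum_list_eq_0_iff intro!: replicate_eqI)
  then show ?case by simp
next
  case (2 m)
  have "{ns::nat list. length ns = length [] \<and> sum_list ns = Suc m} = {}" by auto
  then show ?case by (metis complete_homogeneous.simps(2) sum.empty)
next
  case (3 m x xs)
  let ?C = "\<lambda>k m. {ns::nat list. length ns = k \<and> sum_list ns = m}"
  let ?inc = "\<lambda>ns. Suc (hd ns) # tl ns"
  let ?mon = "\<lambda>xs ns. \<Prod>i<length xs. (xs ! i) ^ (ns ! i)"
  \<comment> \<open>\<open>?A\<close> collects the lists with first exponent 0; \<open>?B\<close>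
    those with a positive one, each obtained by raising the head of a list of sum
    \<open>m\<close>.\<close>
  have split: "?C (Suc (length xs)) (Suc m) =
      (#) 0 ` ?C (length xs) (Suc m) \<union> ?inc ` ?C (Suc (length xs)) m" (is "?L = ?A \<union> ?B")
  proof (intro equalityI subsetI)
    fix ns assume ns: "ns \<in> ?L"
    then obtain n ms where nms: "ns = n # ms" by (auto simp: length_Suc_conv)
    show "ns \<in> ?A \<union> ?B"
    proof (cases n)
      case 0
      then show ?thesis using ns nms by auto
    next
      case (Suc n')
      then have "ns = ?inc (n' # ms)" "n' # ms \<in> ?C (Suc (length xs)) m"
        using ns nms by auto
      then show ?thesis by blast
    qed
  qed (auto simp: length_Suc_conv)
  have inj: "inj_on ?inc (?C (Suc (length xs)) m)"
    by (rule inj_on_inverseI[where g = "\<lambda>ns. (hd ns - 1) # tl ns"]) (auto simp: length_Suc_conv)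
  have "(\<Sum>ns\<in>?L. ?mon (x # xs) ns) = (\<Sum>ns\<in>?A. ?mon (x # xs) ns) + (\<Sum>ns\<in>?B. ?mon (x # xs) ns)"
    unfolding split by (rule sum.union_disjoint) (auto simp: finite_lists_length_sum)
  also have "(\<Sum>ns\<in>?A. ?mon (x # xs) ns) = (\<Sum>ns\<in>?C (length xs) (Suc m). ?mon xs ns)"
    by (subst sum.reindex) (auto simp: prod.lessThan_Suc_shift simp del: prod.lessThan_Suc)
  also have "\<dots> = complete_homogeneous (Suc m) xs"
    by (rule "3.IH"(1))
  also have "(\<Sum>ns\<in>?B. ?mon (x # xs) ns) = (\<Sum>ns\<in>?C (Suc (length xs)) m. x * ?mon (x # xs) ns)"
    unfolding sum.reindex[OF inj]
    by (rule sum.cong) (auto simp: length_Suc_conv prod.lessThan_Suc_shift mult.assoc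
      simp del: prod.lessThan_Suc)
  also have "\<dots> = x * complete_homogeneous m (x # xs)"
    using "3.IH"(2) unfolding sum_distrib_left[symmetric] by simp
  finally show ?case by simp
qed

text \<open>The exponent is written as in \<open>divided_difference_power\<close>, and the
  coefficient stands on the right as in \<open>divided_difference_mult_right\<close>.\<close>

lemma sums_power_mult_exp_k:
  assumes "k \<ge> 1"
  shows "(\<lambda>m. x ^ (m + (k - 1)) * (1 / fact (m + k))) sums (x ^ (k - 1) * exp_k k x)"
proof -
  have "summable (\<lambda>n. x ^ n / fact (n + k))"
  proof (rule summable_comparison_test')
    show "summable (\<lambda>n. \<bar>x\<bar> ^ n / fact n)"
      using summable_exp[of "\<bar>x\<bar>"] by (simp add: field_simps)
    show "norm (x ^ n / fact (n + k)) \<le> \<bar>x\<bar> ^ n / fact n" for n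
      by (auto simp: power_abs intro!: divide_left_mono fact_mono)
  qed
  then have "(\<lambda>n. x ^ n / fact (n + k)) sums exp_k k x"
    unfolding exp_k_def by (rule summable_sums)
  from sums_mult[OF this, of "x ^ (k - 1)"] show ?thesis
    by (simp add: power_add mult_ac)
qed

lemma S_sums_complete_homogeneous:
  "(\<lambda>m. prod_list xs * (complete_homogeneous m xs * (1 / fact (m + length xs)))) sums
     S (length xs) xs"
proof -
  let ?D = "{ns::nat list. length ns = length xs}"
  let ?C = "\<lambda>m. {ns::nat list. length ns = length xs \<and> sum_list ns = m}"
  let ?T = "\<lambda>ns. S_term xs (map Suc ns)"
  have "S_term xs summable_on {ns. length ns = length xs \<and> (\<forall>n\<in>set ns. n \<ge> 1)}"
    by (rule summable_on_subset_banach[OF summable_on_S_term]) auto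
  then have summ: "?T summable_on ?D"
    unfolding summable_on_reindex_bij_betw[OF bij_betw_map_Suc, symmetric] .
  then have "(?T has_sum S (length xs) xs) ?D"
    by (simp add: S_def iterated_series_eq_infsum)
  \<comment> \<open>Each exponent list lies in exactly one \<open>?C m\<close>, namely for m its
    sum, so the unordered sum may be taken degree by degree, with finite inner sums.\<close>
  moreover have bij: "bij_betw snd (Sigma UNIV ?C) ?D"
    by (auto simp: bij_betw_def inj_on_def image_iff)
  ultimately have "((\<lambda>p. ?T (snd p)) has_sum S (length xs) xs) (Sigma UNIV ?C)"
    using has_sum_reindex_bij_betw[OF bij, where f = ?T] by blast
  then have "((\<lambda>m. \<Sum>ns\<in>?C m. ?T ns) has_sum S (length xs) xs) UNIV"
    by (rule has_sum_SigmaD) (auto intro!: has_sum_finiteI finite_lists_length_sum)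
  moreover have "(\<Sum>ns\<in>?C m. ?T ns) =
      prod_list xs * (complete_homogeneous m xs * (1 / fact (m + length xs)))" for m
    unfolding sum_monomials_eq_complete_homogeneous[symmetric] sum_distrib_left sum_distrib_right
    by (rule sum.cong) (auto simp: S_term_map_Suc)
  ultimately show ?thesis
    by (intro has_sum_imp_sums) simp
qed

theorem mainTheorem5:
  fixes k :: nat and xs :: "real list"
  assumes "k \<ge> 1" and "length xs = k" and "distinct xs"
  shows "S_term xs summable_on {ns. length ns = k \<and> (\<forall>n\<in>set ns. n \<ge> 1)}
    \<and> S k xs = prod_list xs * divided_difference xs (\<lambda>x. x ^ (k - 1) * exp_k k x)"
proof
  \<comment> \<open>This summability ensures that the nested series in \<open>S\<close> are
    convergent rather than arbitrary values of \<open>suminf\<close>.\<close>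
  show "S_term xs summable_on {ns. length ns = k \<and> (\<forall>n\<in>set ns. n \<ge> 1)}"
    by (rule summable_on_subset_banach[OF summable_on_S_term]) (auto simp: assms)
  have "xs \<noteq> []" using assms by auto
  \<comment> \<open>The divided difference is applied termwise; the coefficients do not depend on x,
    so they come out and leave divided differences of powers.\<close>
  have "(\<lambda>m. divided_difference xs (\<lambda>x. x ^ (m + (k - 1)) * (1 / fact (m + k)))) sums
      divided_difference xs (\<lambda>x. x ^ (k - 1) * exp_k k x)"
    by (intro sums_divided_difference sums_power_mult_exp_k assms)
  then have "(\<lambda>m. complete_homogeneous m xs * (1 / fact (m + k))) sums
      divided_difference xs (\<lambda>x. x ^ (k - 1) * exp_k k x)"
    unfolding divided_difference_mult_right
    using divided_difference_power[OF assms(3) \<open>xs \<noteq> []\<close>] by (simp add: assms(2))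
  \<comment> \<open>After multiplication by x_1 ... x_k the terms are those of the degree-grouped
    series for \<open>S\<close>, and limits are unique.\<close>
  from sums_mult[OF this, of "prod_list xs"]
  show "S k xs = prod_list xs * divided_difference xs (\<lambda>x. x ^ (k - 1) * exp_k k x)"
    using S_sums_complete_homogeneous[of xs] unfolding assms(2) by (rule sums_unique2[symmetric])
qed

end
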